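(* Let $Q$ be an $\epsilon$-LDP-Rec mechanism that uses a random key $U\in\mathcal{U}$ and an input $X\in\mathcal{X}$, where $|\mathcal{X}|=k$, to produce a privatized output $Y\in\mathcal{Y}$. The following conditions are necessary and sufficient to allow recovery of $X$ from $(U,Y)$: (1) $|\mathcal{U}|\geq |\mathcal{Y}|\geq |\mathcal{X}|$. (2) The entropy of the random key must satisfy $H(U)\geq H(U_{\min}^{s^{*}})$, where $s^{*}=\arg\min_{s\in\{\lceil l\rceil,\lfloor l\rfloor\}}H(U_{\min}^{s})$ for $l=k\,\frac{e^{\epsilon}(\epsilon-1)+1}{(e^{\epsilon}-1)^2}$, and $U_{\min}^{s}$ is a random variable with support size equal to $|\mathcal{X}|=k$ and with distribution $$\mathbf{q}_{\min}^{s}=[1/t,\ldots,1/t,\,e^{\epsilon}/t,\ldots,e^{\epsilon}/t],\qquad t=se^{\epsilon}+k-s,$$ in which the first $k-s$ terms are equal to $1/t$ and the remaining $s$ terms are equal to $e^{\epsilon}/t$.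
   Context: $H$ denotes Shannon entropy. The random key $U$ is a random variable taking values in a discrete set $\mathcal{U}$. A mechanism $Q$ using the key $U$ produces an output $Y\in\mathcal{Y}$ that is a deterministic function of $(X,U)$; $Q(y|x)=\Pr[Y=y\mid X=x]$ is the total probability of the key values for which input $x$ is mapped to output $y$. $Q$ is $\epsilon$-LDP (locally differentially private) if $\sup_{y\in\mathcal{Y}}Q(y|x)/Q(y|x')\le e^{\epsilon}$ for every pair of inputs $x,x'\in\mathcal{X}$. $Q$ is $\epsilon$-LDP-Rec if it is $\epsilon$-LDP and it is possible to recover the input $X$ from the output $Y$ and the key $U$. No assumption is made on the distribution of $X$. When $\epsilon=0$ the distribution $\mathbf{q}_{\min}^{s}$ is uniform on $k$ values irrespective of $s$.
   Formalization: Sufficiency is read as: if alphabets satisfy (1) and an entropy budget satisfies (2), some key and mechanism within them (outputs possibly a subset of Y) is ε-LDP-Rec; for every given key it is false (k=2, ε=0, U~(0.6,0.2,0.2)). Y is the set of outputs that occur. *)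

theory Defs
  imports "HOL-Probability.Probability" "HOL-Library.Equipollence"
begin

(* Shannon entropy in bits of a discrete random variable with law p, as the expected
   self-information.  It is ennreal-valued because a key with infinitely many values may have
   infinite entropy; the real-valued "entropy" of information_space returns 0 when the
   defining integral diverges. *)
definition pmf_entropy :: "'a pmf \<Rightarrow> ennreal" where
  "pmf_entropy p = (\<integral>\<^sup>+ a. ennreal (- log 2 (pmf p a)) \<partial>measure_pmf p)"

lemma pmf_entropy_finite:
  assumes "finite (set_pmf p)"
  shows "pmf_entropy p = ennreal (\<Sum>a\<in>set_pmf p. - pmf p a * log 2 (pmf p a))"
proof -
  have le0: "log 2 (pmf p a) \<le> 0" if "a \<in> set_pmf p" for a
    using that pmf_le_1[of p a] by (simp add: pmf_positive)
  have "pmf_entropy p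
      = (\<Sum>a\<in>set_pmf p. ennreal (- log 2 (pmf p a)) * ennreal (pmf p a))"
    unfolding pmf_entropy_def using assms by (intro nn_integral_measure_pmf_finite) auto
  also have "\<dots> = (\<Sum>a\<in>set_pmf p. ennreal (- pmf p a * log 2 (pmf p a)))"
    by (intro sum.cong refl) (simp add: ennreal_mult'[symmetric] mult.commute le0)
  also have "\<dots> = ennreal (\<Sum>a\<in>set_pmf p. - pmf p a * log 2 (pmf p a))"
    by (intro sum_ennreal) (simp add: le0 mult_nonneg_nonpos)
  finally show ?thesis .
qed

(* A mechanism is given by the law U of its key and the map f producing the output
   Y = f x u from input x and key value u.  mech_prob U f x y is Q(y|x); the key is independent
   of the input, so no distribution on the inputs enters. *)
definition mech_prob :: "'u pmf \<Rightarrow> ('x \<Rightarrow> 'u \<Rightarrow> 'y) \<Rightarrow> 'x \<Rightarrow> 'y \<Rightarrow> real" where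
  "mech_prob U f x y = measure_pmf.prob U {u. f x u = y}"

(* YY is exactly the set of outputs that can occur: with unused symbols allowed in YY, its
   cardinality would be unrelated to the mechanism. *)
definition key_mechanism ::
  "'x set \<Rightarrow> 'u set \<Rightarrow> 'y set \<Rightarrow> 'u pmf \<Rightarrow> ('x \<Rightarrow> 'u \<Rightarrow> 'y) \<Rightarrow> bool" where
  "key_mechanism XX UU YY U f \<longleftrightarrow>
     set_pmf U \<subseteq> UU \<and> (\<Union>x\<in>XX. f x ` set_pmf U) = YY"

(* The quotient is taken in ennreal, where a / 0 = top for a > 0 and 0 / 0 = 0; with real
   division a zero denominator would make the bound hold vacuously. *)
definition ldp ::
  "'x set \<Rightarrow> 'y set \<Rightarrow> real \<Rightarrow> 'u pmf \<Rightarrow> ('x \<Rightarrow> 'u \<Rightarrow> 'y) \<Rightarrow> bool" where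
  "ldp XX YY \<epsilon> U f \<longleftrightarrow>
     (\<forall>x\<in>XX. \<forall>x'\<in>XX.
        (SUP y\<in>YY. ennreal (mech_prob U f x y) / ennreal (mech_prob U f x' y))
          \<le> ennreal (exp \<epsilon>))"

definition recoverable :: "'x set \<Rightarrow> 'u pmf \<Rightarrow> ('x \<Rightarrow> 'u \<Rightarrow> 'y) \<Rightarrow> bool" where
  "recoverable XX U f \<longleftrightarrow> (\<exists>g. \<forall>x\<in>XX. \<forall>u\<in>set_pmf U. g u (f x u) = x)"

definition ldp_rec ::
  "'x set \<Rightarrow> 'u set \<Rightarrow> 'y set \<Rightarrow> real \<Rightarrow> 'u pmf \<Rightarrow> ('x \<Rightarrow> 'u \<Rightarrow> 'y) \<Rightarrow> bool" where
  "ldp_rec XX UU YY \<epsilon> U f \<longleftrightarrow>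
     key_mechanism XX UU YY U f \<and> ldp XX YY \<epsilon> U f \<and> recoverable XX U f"

definition t_min :: "real \<Rightarrow> nat \<Rightarrow> nat \<Rightarrow> real" where
  "t_min \<epsilon> k s = real s * exp \<epsilon> + real k - real s"

definition q_min :: "real \<Rightarrow> nat \<Rightarrow> nat \<Rightarrow> nat \<Rightarrow> real" where
  "q_min \<epsilon> k s i =
     (if i < k - s then 1 / t_min \<epsilon> k s
      else if i < k then exp \<epsilon> / t_min \<epsilon> k s
      else 0)"

(* The law of U_min^s, on {0..<k}; q_min is a probability vector for s \<le> k
   (lemmas pmf_U_min and s_star_le). *)
definition U_min :: "real \<Rightarrow> nat \<Rightarrow> nat \<Rightarrow> nat pmf" where
  "U_min \<epsilon> k s = embed_pmf (q_min \<epsilon> k s)"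

(* For \<epsilon> = 0 the quotient is 0 / 0 = 0, which is harmless: U_min 0 k s is uniform
   on {0..<k} for every s \<le> k. *)
definition l_opt :: "real \<Rightarrow> nat \<Rightarrow> real" where
  "l_opt \<epsilon> k = real k * ((exp \<epsilon> * (\<epsilon> - 1) + 1) / (exp \<epsilon> - 1)\<^sup>2)"

definition s_star :: "real \<Rightarrow> nat \<Rightarrow> nat" where
  "s_star \<epsilon> k =
     arg_min_on (\<lambda>s. pmf_entropy (U_min \<epsilon> k s))
       {nat \<lceil>l_opt \<epsilon> k\<rceil>, nat \<lfloor>l_opt \<epsilon> k\<rfloor>}"

lemma t_min_pos:
  assumes "s \<le> k" "k > 0"
  shows "t_min \<epsilon> k s > 0"
proof (cases "s = 0")
  case False
  have "real s * exp \<epsilon> > 0" using False by simp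
  moreover have "real k - real s \<ge> 0" using assms by simp
  ultimately show ?thesis unfolding t_min_def by linarith
qed (use assms in \<open>simp add: t_min_def\<close>)

lemma pmf_U_min:
  assumes "s \<le> k" "k > 0"
  shows "pmf (U_min \<epsilon> k s) i = q_min \<epsilon> k s i"
proof -
  define t where "t = t_min \<epsilon> k s"
  have t: "t > 0" unfolding t_def by (rule t_min_pos[OF assms])
  have nonneg: "q_min \<epsilon> k s j \<ge> 0" for j
    using t unfolding q_min_def t_def[symmetric] by simp
  have "(\<Sum>j<k. q_min \<epsilon> k s j)
      = (\<Sum>j\<in>{..<k - s}. q_min \<epsilon> k s j) + (\<Sum>j\<in>{k - s..<k}. q_min \<epsilon> k s j)"
    by (subst sum.union_disjoint[symmetric]) (auto intro!: sum.cong)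
  also have "(\<Sum>j\<in>{..<k - s}. q_min \<epsilon> k s j) = real (k - s) * (1 / t)"
    by (simp add: q_min_def t_def)
  also have "(\<Sum>j\<in>{k - s..<k}. q_min \<epsilon> k s j) = real s * (exp \<epsilon> / t)"
    using assms(1) by (simp add: q_min_def t_def)
  also have "real (k - s) * (1 / t) + real s * (exp \<epsilon> / t) = (real k - real s + real s * exp \<epsilon>) / t"
    using assms(1) by (simp add: add_divide_distrib)
  also have "\<dots> = 1"
    using t by (simp add: t_def t_min_def algebra_simps)
  finally have sum1: "(\<Sum>j<k. q_min \<epsilon> k s j) = 1" .
  have "(\<integral>\<^sup>+ j. ennreal (q_min \<epsilon> k s j) \<partial>count_space UNIV)
      = (\<Sum>j<k. ennreal (q_min \<epsilon> k s j))"
    by (rule nn_integral_count_space') (auto simp: q_min_def)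
  also have "\<dots> = 1"
    by (simp add: sum_ennreal nonneg sum1)
  finally show ?thesis
    unfolding U_min_def by (intro pmf_embed_pmf nonneg) simp
qed

lemma l_opt_le:
  assumes "\<epsilon> \<ge> 0"
  shows "l_opt \<epsilon> k \<le> real k"
proof (cases "\<epsilon> = 0")
  case False
  have "exp \<epsilon> - 1 - \<epsilon> \<ge> 0"
    using exp_ge_add_one_self[of \<epsilon>] by linarith
  then have "exp \<epsilon> * (exp \<epsilon> - 1 - \<epsilon>) \<ge> 0"
    by (intro mult_nonneg_nonneg) auto
  then have "exp \<epsilon> * (\<epsilon> - 1) + 1 \<le> (exp \<epsilon> - 1)\<^sup>2"
    by (simp add: power2_eq_square algebra_simps)
  then have "(exp \<epsilon> * (\<epsilon> - 1) + 1) / (exp \<epsilon> - 1)\<^sup>2 \<le> 1"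
    using False by (simp add: divide_le_eq)
  then show ?thesis
    unfolding l_opt_def by (intro mult_left_le) auto
qed (simp add: l_opt_def)

lemma s_star_le:
  assumes "\<epsilon> \<ge> 0"
  shows "s_star \<epsilon> k \<le> k"
proof -
  have "s_star \<epsilon> k \<in> {nat \<lceil>l_opt \<epsilon> k\<rceil>, nat \<lfloor>l_opt \<epsilon> k\<rfloor>}"
    unfolding s_star_def by (rule arg_min_if_finite(1)) auto
  moreover have "nat \<lceil>l_opt \<epsilon> k\<rceil> \<le> k" "nat \<lfloor>l_opt \<epsilon> k\<rfloor> \<le> k"
    using l_opt_le[OF assms, of k] by linarith+
  ultimately show ?thesis by auto
qed

end

theory Submission
  imports Defs
begin

text \<open>Recoverability makes \<open>x \<mapsto> f x u\<close> injective for every key value \<open>u\<close>, so each column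
  \<open>(Q(y|x))\<^sub>x\<close> has sum at most 1, and its entropy contribution is at least its sum times
  the entropy of the normalised column. The latter has all ratios bounded by \<open>e\<^sup>\<epsilon>\<close>; by
  concavity its entropy is smallest when it takes only two values with ratio \<open>e\<^sup>\<epsilon>\<close>, that is,
  at some \<open>q_min \<epsilon> k s\<close>, and calculus in \<open>s\<close> shows that the best integer \<open>s\<close> is next to
  \<open>l_opt \<epsilon> k\<close>. The columns together have total weight \<open>k\<close>, so averaging over \<open>x\<close> bounds
  the entropy of the key.\<close>

section \<open>Entropy of a discrete law and of its images\<close>

text \<open>Points off the support contribute \<open>0 * log 2 0 = 0\<close>. The common measure on
  the right lets the entropies of different laws be added under one integral.\<close>

lemma pmf_entropy_count_space:
  "pmf_entropy p = (\<integral>\<^sup>+ a. ennreal (- pmf p a * log 2 (pmf p a)) \<partial>count_space UNIV)"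
proof -
  have "ennreal (pmf p a) * ennreal (- log 2 (pmf p a)) = ennreal (- pmf p a * log 2 (pmf p a))" for a
    by (subst ennreal_mult'[symmetric]) auto
  then show ?thesis
    unfolding pmf_entropy_def nn_integral_measure_pmf by simp
qed

text \<open>A map can only merge atoms, so each point's image has at least its probability and at
  most its self-information. The comparison is pointwise and therefore also covers infinite
  entropy.\<close>

lemma pmf_entropy_map_le: "pmf_entropy (map_pmf g p) \<le> pmf_entropy p"
proof -
  have "- log 2 (pmf (map_pmf g p) (g a)) \<le> - log 2 (pmf p a)" if "a \<in> set_pmf p" for a
  proof -
    have "pmf p a \<le> pmf (map_pmf g p) (g a)"
      unfolding pmf_map by (subst measure_pmf_single[symmetric]) (rule measure_pmf.finite_measure_mono, auto)
    with that show ?thesis by (simp add: pmf_positive)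
  qed
  then show ?thesis
    unfolding pmf_entropy_def
    by (simp add: nn_integral_map_pmf) (intro nn_integral_mono_AE AE_pmfI ennreal_leI, simp)
qed

lemma pmf_entropy_map_inj:
  assumes "inj_on g (set_pmf p)"
  shows "pmf_entropy (map_pmf g p) = pmf_entropy p"
  unfolding pmf_entropy_def
  by (simp add: nn_integral_map_pmf)
     (intro nn_integral_cong_AE AE_pmfI, simp add: pmf_map_inj[OF assms])

section \<open>Entropy of two-level laws and its best integer parameter\<close>

text \<open>The entropy of \<open>U_min \<epsilon> k s\<close> in nats, for real \<open>s\<close>.\<close>

definition two_level_entropy :: "real \<Rightarrow> nat \<Rightarrow> real \<Rightarrow> real" where
  "two_level_entropy \<epsilon> k s =
     ln (s * exp \<epsilon> + real k - s) - s * \<epsilon> * exp \<epsilon> / (s * exp \<epsilon> + real k - s)"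

lemma set_pmf_U_min:
  assumes "s \<le> k" "k > 0"
  shows "set_pmf (U_min \<epsilon> k s) = {..<k}"
  using t_min_pos[OF assms, of \<epsilon>]
  by (auto simp: set_pmf_eq pmf_U_min[OF assms] q_min_def split: if_splits)

lemma pmf_entropy_U_min:
  assumes "s \<le> k" "k > 0"
  shows "pmf_entropy (U_min \<epsilon> k s) = ennreal (two_level_entropy \<epsilon> k s / ln 2)"
proof -
  define t where "t = t_min \<epsilon> k s"
  have t: "t > 0" unfolding t_def by (rule t_min_pos[OF assms])
  let ?\<phi> = "\<lambda>x::real. - x * log 2 x"
  have "(\<Sum>j<k. ?\<phi> (q_min \<epsilon> k s j))
      = (\<Sum>j\<in>{..<k - s}. ?\<phi> (q_min \<epsilon> k s j)) + (\<Sum>j\<in>{k - s..<k}. ?\<phi> (q_min \<epsilon> k s j))"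
    by (subst sum.union_disjoint[symmetric]) (auto intro!: sum.cong)
  also have "(\<Sum>j\<in>{..<k - s}. ?\<phi> (q_min \<epsilon> k s j)) = real (k - s) * ?\<phi> (1 / t)"
    by (simp add: q_min_def t_def)
  also have "(\<Sum>j\<in>{k - s..<k}. ?\<phi> (q_min \<epsilon> k s j)) = real s * ?\<phi> (exp \<epsilon> / t)"
    using assms(1) by (simp add: q_min_def t_def)
  also have "real (k - s) * ?\<phi> (1 / t) + real s * ?\<phi> (exp \<epsilon> / t)
      = ((real k - real s + real s * exp \<epsilon>) / t * ln t - real s * \<epsilon> * exp \<epsilon> / t) / ln 2"
  proof -
    have log: "log 2 (1 / t) = - ln t / ln 2" "log 2 (exp \<epsilon> / t) = (\<epsilon> - ln t) / ln 2"
      using t by (simp_all add: log_def ln_div)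
    show ?thesis
      unfolding log using t assms(1) by (simp add: of_nat_diff divide_simps) (simp add: algebra_simps)
  qed
  also have "(real k - real s + real s * exp \<epsilon>) / t = 1"
    using t by (simp add: t_def t_min_def algebra_simps)
  finally show ?thesis
    by (subst pmf_entropy_finite)
       (simp_all add: set_pmf_U_min[OF assms] pmf_U_min[OF assms] two_level_entropy_def
          t_def[unfolded t_min_def])
qed

text \<open>This is where \<open>l_opt\<close> comes from: the numerator of the derivative is affine
  in \<open>s\<close>, since the terms in \<open>s * \<epsilon>\<close> cancel, and
  \<open>l_opt\<close> is its zero. The sign of the derivative is that of
  \<open>s - l_opt \<epsilon> k\<close>.\<close>

lemma two_level_entropy_deriv:
  assumes "0 \<le> s" "s \<le> real k" "k > 0" "\<epsilon> > 0"
  shows "(two_level_entropy \<epsilon> k has_real_derivative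
           (exp \<epsilon> - 1)\<^sup>2 * (s - l_opt \<epsilon> k) / (s * exp \<epsilon> + real k - s)\<^sup>2) (at s)"
proof -
  let ?t = "s * exp \<epsilon> + real k - s"
  have "s * (exp \<epsilon> - 1) \<ge> 0" using assms by simp
  then have t: "?t > 0" using assms by (simp add: algebra_simps)
  have a: "exp \<epsilon> - 1 > 0" using assms by simp
  have l: "(exp \<epsilon> - 1)\<^sup>2 * l_opt \<epsilon> k = real k * (exp \<epsilon> * (\<epsilon> - 1) + 1)"
    using a by (simp add: l_opt_def)
  have "(two_level_entropy \<epsilon> k has_real_derivative
          (exp \<epsilon> - 1) / ?t - (\<epsilon> * exp \<epsilon> * ?t - s * \<epsilon> * exp \<epsilon> * (exp \<epsilon> - 1)) / (?t * ?t)) (at s)"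
    unfolding two_level_entropy_def
    using t by (auto intro!: derivative_eq_intros simp: field_simps)
  moreover have "(exp \<epsilon> - 1) / ?t - (\<epsilon> * exp \<epsilon> * ?t - s * \<epsilon> * exp \<epsilon> * (exp \<epsilon> - 1)) / (?t * ?t)
      = ((exp \<epsilon> - 1) * ?t - (\<epsilon> * exp \<epsilon> * ?t - s * \<epsilon> * exp \<epsilon> * (exp \<epsilon> - 1))) / ?t\<^sup>2"
    using t by (simp add: diff_divide_distrib power2_eq_square)
  moreover have "(exp \<epsilon> - 1) * ?t - (\<epsilon> * exp \<epsilon> * ?t - s * \<epsilon> * exp \<epsilon> * (exp \<epsilon> - 1))
      = (exp \<epsilon> - 1)\<^sup>2 * (s - l_opt \<epsilon> k)"
    unfolding right_diff_distrib[of "(exp \<epsilon> - 1)\<^sup>2"] l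
    by (simp add: power2_eq_square algebra_simps)
  ultimately show ?thesis by simp
qed

text \<open>Multiply the tangent bound for \<open>exp\<close> at \<open>- \<epsilon>\<close> by
  \<open>exp \<epsilon>\<close>. Nonnegativity ensures that \<open>nat\<close> does not truncate the
  floor of \<open>l_opt\<close>.\<close>

lemma l_opt_nonneg: "l_opt \<epsilon> k \<ge> 0"
proof -
  have "1 - \<epsilon> \<le> exp (- \<epsilon>)" using exp_ge_add_one_self[of "- \<epsilon>"] by simp
  then have "exp \<epsilon> * (1 - \<epsilon>) \<le> exp \<epsilon> * exp (- \<epsilon>)" by (intro mult_left_mono) auto
  then have "exp \<epsilon> * (\<epsilon> - 1) + 1 \<ge> 0" by (simp add: exp_minus algebra_simps)
  then show ?thesis by (simp add: l_opt_def)
qed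

text \<open>The entropy decreases up to \<open>l_opt\<close> and increases after it, so moving an
  integer \<open>s\<close> towards \<open>l_opt\<close>, to the nearest integer on its own side,
  does not raise the entropy.\<close>

lemma two_level_entropy_rounding:
  assumes "\<epsilon> \<ge> 0" "k > 0" "s \<le> k"
  shows "\<exists>r\<in>{nat \<lceil>l_opt \<epsilon> k\<rceil>, nat \<lfloor>l_opt \<epsilon> k\<rfloor>}.
           two_level_entropy \<epsilon> k r \<le> two_level_entropy \<epsilon> k s"
proof (cases "\<epsilon> = 0")
  case True
  \<comment> \<open>Here every parameter gives the value \<open>ln k\<close>.\<close>
  then show ?thesis by (auto simp: two_level_entropy_def)
next
  case False
  with assms have e: "\<epsilon> > 0" by simp
  let ?l = "l_opt \<epsilon> k"
  have l0: "?l \<ge> 0" and lk: "?l \<le> real k"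
    using l_opt_nonneg l_opt_le[OF assms(1)] by auto
  show ?thesis
  proof (cases "real s \<le> ?l")
    case True
    let ?r = "real (nat \<lfloor>?l\<rfloor>)"
    have r: "real s \<le> ?r" "?r \<le> ?l"
      using le_nat_floor[OF True] l0 by (simp_all only: of_nat_le_iff of_nat_floor)
    have "two_level_entropy \<epsilon> k ?r \<le> two_level_entropy \<epsilon> k s"
    proof (rule DERIV_nonpos_imp_nonincreasing[OF r(1)])
      fix x assume x: "real s \<le> x" "x \<le> ?r"
      then have X: "0 \<le> x" "x \<le> real k" "x \<le> ?l" using r lk by linarith+
      let ?D = "(exp \<epsilon> - 1)\<^sup>2 * (x - ?l) / (x * exp \<epsilon> + real k - x)\<^sup>2"
      have "(two_level_entropy \<epsilon> k has_real_derivative ?D) (at x)"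
        by (rule two_level_entropy_deriv) fact+
      moreover have "?D \<le> 0"
        using X by (auto simp: divide_nonpos_nonneg mult_nonneg_nonpos)
      ultimately show "\<exists>y. (two_level_entropy \<epsilon> k has_real_derivative y) (at x) \<and> y \<le> 0"
        by blast
    qed
    then show ?thesis by auto
  next
    case False
    let ?r = "real (nat \<lceil>?l\<rceil>)"
    have r: "?r \<le> real s" "?l \<le> ?r" using False real_nat_ceiling_ge by (auto simp: nat_ceiling_le_eq)
    have "two_level_entropy \<epsilon> k ?r \<le> two_level_entropy \<epsilon> k s"
    proof (rule DERIV_nonneg_imp_nondecreasing[OF r(1)])
      fix x assume x: "?r \<le> x" "x \<le> real s"
      then have X: "0 \<le> x" "x \<le> real k" "?l \<le> x" using r assms l0 by linarith+
      let ?D = "(exp \<epsilon> - 1)\<^sup>2 * (x - ?l) / (x * exp \<epsilon> + real k - x)\<^sup>2"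
      have "(two_level_entropy \<epsilon> k has_real_derivative ?D) (at x)"
        by (rule two_level_entropy_deriv) fact+
      moreover have "0 \<le> ?D"
        using X by (auto simp: divide_nonpos_nonneg mult_nonneg_nonpos)
      ultimately show "\<exists>y. (two_level_entropy \<epsilon> k has_real_derivative y) (at x) \<and> 0 \<le> y"
        by blast
    qed
    then show ?thesis by auto
  qed
qed

text \<open>With \<open>t\<close> the normalising constant, the subtracted term is at most
  \<epsilon> because \<open>s * exp \<epsilon> \<le> t\<close>, and \<open>ln t\<close> is at least
  \<epsilon> because \<open>exp \<epsilon> \<le> t\<close>. This makes \<open>ennreal\<close>
  faithful on these values.\<close>

lemma two_level_entropy_nonneg:
  assumes "\<epsilon> \<ge> 0" "k > 0" "s \<le> k"
  shows "two_level_entropy \<epsilon> k s \<ge> 0"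
proof (cases "s = 0")
  case True
  with assms show ?thesis by (simp add: two_level_entropy_def)
next
  case False
  let ?t = "real s * exp \<epsilon> + real k - real s"
  have "1 * exp \<epsilon> \<le> real s * exp \<epsilon>" using False by (intro mult_right_mono) auto
  then have t: "exp \<epsilon> \<le> ?t" "real s * exp \<epsilon> \<le> ?t"
    using of_nat_mono[OF assms(3), where ?'a = real] by linarith+
  have pos: "?t > 0" using t(1) exp_gt_zero[of \<epsilon>] by linarith
  have "real s * \<epsilon> * exp \<epsilon> / ?t = \<epsilon> * (real s * exp \<epsilon> / ?t)" by simp
  also have "\<dots> \<le> \<epsilon> * 1" using t(2) pos assms(1) by (intro mult_left_mono) auto
  also have "\<dots> \<le> ln ?t" using t(1) pos by (simp add: ln_ge_iff)
  finally show ?thesis by (simp add: two_level_entropy_def)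
qed

lemma two_level_entropy_s_star_le:
  assumes "\<epsilon> \<ge> 0" "k > 0" "s \<le> k"
  shows "two_level_entropy \<epsilon> k (s_star \<epsilon> k) \<le> two_level_entropy \<epsilon> k s"
proof -
  let ?S = "{nat \<lceil>l_opt \<epsilon> k\<rceil>, nat \<lfloor>l_opt \<epsilon> k\<rfloor>}"
  obtain r where r: "r \<in> ?S" "two_level_entropy \<epsilon> k r \<le> two_level_entropy \<epsilon> k s"
    using two_level_entropy_rounding[OF assms] by blast
  have "r \<le> k" using r(1) l_opt_le[OF assms(1), of k] by auto linarith+
  have "pmf_entropy (U_min \<epsilon> k (s_star \<epsilon> k)) \<le> pmf_entropy (U_min \<epsilon> k r)"
    unfolding s_star_def by (rule arg_min_least) (use r(1) in auto)
  then have "two_level_entropy \<epsilon> k (s_star \<epsilon> k) \<le> two_level_entropy \<epsilon> k r"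
    using assms \<open>r \<le> k\<close> s_star_le[OF assms(1), of k]
    by (simp add: pmf_entropy_U_min ennreal_le_iff two_level_entropy_nonneg divide_le_cancel)
  with r(2) show ?thesis by simp
qed

section \<open>Minimal entropy under a bound on ratios\<close>

text \<open>A concave function that is nonnegative at both ends of an interval is nonnegative
  inside. Concavity holds because \<open>R \<ge> 0\<close> makes the second derivative
  \<open>1 / (R + x) - 1 / x\<close> nonpositive.\<close>

lemma entropy_coordinate_endpoints:
  fixes R K c m M x :: real
  defines "g \<equiv> \<lambda>x. (R + x) * ln (R + x) - (K + x * ln x) - c * (R + x)"
  assumes "R \<ge> 0" "m > 0" "m \<le> x" "x \<le> M" "g m \<ge> 0" "g M \<ge> 0"
  shows "g x \<ge> 0"
proof -
  have "concave_on {m..M} g"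
  proof (rule f''_le0_imp_concave)
    fix x assume "x \<in> {m..M}"
    then have x: "x > 0" "R + x > 0" using assms by auto
    show "(g has_real_derivative ln (R + x) - ln x - c) (at x)"
      unfolding g_def using x by (auto intro!: derivative_eq_intros)
    show "((\<lambda>x. ln (R + x) - ln x - c) has_real_derivative 1 / (R + x) - 1 / x) (at x)"
      using x by (auto intro!: derivative_eq_intros)
    show "1 / (R + x) - 1 / x \<le> 0"
      using x assms by (simp add: frac_le)
  qed auto
  moreover have "x \<in> closed_segment m M"
    using assms by (simp add: closed_segment_eq_real_ivl)
  then obtain u where u: "0 \<le> u" "u \<le> 1" "x = (1 - u) * m + u * M"
    by (auto simp: in_segment)
  ultimately have "g x \<ge> (1 - u) * g m + u * g M"
    using assms concave_onD[of "{m..M}" g u m M] by simp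
  moreover have "(1 - u) * g m + u * g M \<ge> 0"
    using u assms by simp
  ultimately show ?thesis by linarith
qed

text \<open>The expression is concave in each coordinate separately and homogeneous, so the coordinates
  can be pushed to the endpoints one at a time without keeping their sum fixed.\<close>

lemma entropy_reduce_to_endpoints:
  fixes p :: "'x \<Rightarrow> real" and c m M :: real
  defines "G \<equiv> \<lambda>p X. sum p X * ln (sum p X) - (\<Sum>x\<in>X. p x * ln (p x)) - c * sum p X"
  assumes "finite X" "m > 0"
    and endpoints: "\<And>p. (\<And>x. x \<in> X \<Longrightarrow> p x = m \<or> p x = M) \<Longrightarrow> G p X \<ge> 0"
    and bounds: "\<And>x. x \<in> X \<Longrightarrow> m \<le> p x \<and> p x \<le> M"
  shows "G p X \<ge> 0"
proof -
  \<comment> \<open>Induction on a set \<open>A\<close> containing every coordinate that may lie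
    strictly between the endpoints.\<close>
  have "G p X \<ge> 0" if "finite A" "A \<subseteq> X" "\<And>x. x \<in> X \<Longrightarrow> m \<le> p x \<and> p x \<le> M"
    "\<And>x. x \<in> X - A \<Longrightarrow> p x = m \<or> p x = M" for A p
    using that
  proof (induction A arbitrary: p rule: finite_induct)
    case empty
    then show ?case by (intro endpoints) auto
  next
    case (insert i A)
    have i: "i \<in> X" "m \<le> p i" "p i \<le> M" using insert.prems by auto
    then have "m \<le> M" by linarith
    define R where "R = sum p (X - {i})"
    define K where "K = (\<Sum>x\<in>X - {i}. p x * ln (p x))"
    have "p x \<ge> 0" if "x \<in> X" for x
      using insert.prems(2)[OF that] \<open>m > 0\<close> by linarith
    then have R: "R \<ge> 0" unfolding R_def by (intro sum_nonneg) simp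
    \<comment> \<open>With the other coordinates frozen in \<open>R\<close> and \<open>K\<close>,
      this is the one-variable function treated above; \<open>x = p i\<close> gives back
      \<open>p\<close>.\<close>
    have G: "G (p(i := x)) X = (R + x) * ln (R + x) - (K + x * ln x) - c * (R + x)" for x
    proof -
      have "sum (p(i := x)) X = R + x"
        unfolding R_def using i \<open>finite X\<close> by (simp add: sum.remove[of X i])
      moreover have "(\<Sum>y\<in>X. (p(i := x)) y * ln ((p(i := x)) y)) = K + x * ln x"
        unfolding K_def using i \<open>finite X\<close> by (simp add: sum.remove[of X i])
      ultimately show ?thesis unfolding G_def by simp
    qed
    have IH: "G (p(i := z)) X \<ge> 0" if z: "z = m \<or> z = M" for z
    proof (rule insert.IH)
      show "A \<subseteq> X" using insert.prems(1) by simp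
      show "m \<le> (p(i := z)) x \<and> (p(i := z)) x \<le> M" if "x \<in> X" for x
        using insert.prems(2)[OF that] \<open>m \<le> M\<close> z by auto
      show "(p(i := z)) x = m \<or> (p(i := z)) x = M" if "x \<in> X - A" for x
        using insert.prems(3)[of x] that z by auto
    qed
    have "G (p(i := m)) X \<ge> 0" "G (p(i := M)) X \<ge> 0"
      by (rule IH, simp)+
    from entropy_coordinate_endpoints[OF R \<open>m > 0\<close> i(2,3) this[unfolded G]]
    show ?case unfolding G[symmetric] fun_upd_triv .
  qed
  from this[of X p, OF assms(2) order_refl bounds] show ?thesis by simp
qed

text \<open>The right-hand side is the sum of \<open>p\<close> times the entropy in nats of the
  normalised vector. Keeping the sum free permits the coordinatewise reduction to vectors with
  entries \<open>m\<close> and \<open>exp \<epsilon> * m\<close>, which are multiples of two-level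
  laws.\<close>

lemma entropy_bounded_ratio:
  fixes p :: "'x \<Rightarrow> real"
  assumes "finite X" "X \<noteq> {}" "\<epsilon> \<ge> 0" "m > 0"
    and p: "\<And>x. x \<in> X \<Longrightarrow> m \<le> p x \<and> p x \<le> exp \<epsilon> * m"
  shows "two_level_entropy \<epsilon> (card X) (s_star \<epsilon> (card X)) * sum p X
           \<le> sum p X * ln (sum p X) - (\<Sum>x\<in>X. p x * ln (p x))"
proof -
  let ?k = "card X" and ?M = "exp \<epsilon> * m"
  let ?c = "two_level_entropy \<epsilon> ?k (s_star \<epsilon> ?k)"
  have k: "?k > 0" using assms by (simp add: card_gt_0_iff)
  have "sum q X * ln (sum q X) - (\<Sum>x\<in>X. q x * ln (q x)) - ?c * sum q X \<ge> 0"
    if q: "\<And>x. x \<in> X \<Longrightarrow> q x = m \<or> q x = ?M" for q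
  proof -
    \<comment> \<open>For \<open>\<epsilon> = 0\<close> the two levels coincide and \<open>B\<close>
      is all of \<open>X\<close>.\<close>
    define B where "B = {x \<in> X. q x = ?M}"
    define s where "s = card B"
    have B: "B \<subseteq> X" "finite B" using \<open>finite X\<close> by (auto simp: B_def)
    have s: "s \<le> ?k" unfolding s_def using B \<open>finite X\<close> by (simp add: card_mono)
    have split: "(\<Sum>x\<in>X. f (q x)) = (real ?k - real s) * f m + real s * f ?M" for f :: "real \<Rightarrow> real"
    proof -
      have "(\<Sum>x\<in>X. f (q x)) = (\<Sum>x\<in>X - B. f (q x)) + (\<Sum>x\<in>B. f (q x))"
        using B \<open>finite X\<close> by (simp add: sum.subset_diff)
      also have "(\<Sum>x\<in>X - B. f (q x)) = (\<Sum>x\<in>X - B. f m)"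
        using q by (intro sum.cong) (auto simp: B_def)
      also have "(\<Sum>x\<in>B. f (q x)) = (\<Sum>x\<in>B. f ?M)"
        by (intro sum.cong) (auto simp: B_def)
      finally show ?thesis
        using B \<open>finite X\<close> s by (simp add: card_Diff_subset s_def of_nat_diff)
    qed
    define t where "t = t_min \<epsilon> ?k s"
    have t: "t > 0" unfolding t_def using s k by (rule t_min_pos)
    have S: "sum q X = m * t"
      using split[of "\<lambda>x. x"] by (simp add: t_def t_min_def algebra_simps)
    have "sum q X * ln (sum q X) - (\<Sum>x\<in>X. q x * ln (q x))
        = m * t * (ln m + ln t) - ((real ?k - real s) * (m * ln m) + real s * (?M * (\<epsilon> + ln m)))"
      using S split[of "\<lambda>x. x * ln x"] \<open>m > 0\<close> t by (simp add: ln_mult)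
    \<comment> \<open>The terms in \<open>ln m\<close> cancel, since
      \<open>(k - s) + s * exp \<epsilon> = t\<close>.\<close>
    also have "\<dots> = m * (t * ln t - s * \<epsilon> * exp \<epsilon>)"
      by (simp add: t_def t_min_def algebra_simps)
    also have "\<dots> = two_level_entropy \<epsilon> ?k s * (m * t)"
      using t unfolding two_level_entropy_def t_min_def[symmetric] t_def[symmetric]
      by (simp add: field_simps)
    also have "\<dots> \<ge> ?c * (m * t)"
      using two_level_entropy_s_star_le[OF \<open>\<epsilon> \<ge> 0\<close> k s] t \<open>m > 0\<close>
      by (intro mult_right_mono) auto
    finally show ?thesis using S by simp
  qed
  from entropy_reduce_to_endpoints[of X m ?M ?c p, OF \<open>finite X\<close> \<open>m > 0\<close> this p] show ?thesis by simp
qed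

section \<open>Consequences of privacy and recovery for the output probabilities\<close>

lemma ldp_le:
  assumes "ldp XX YY \<epsilon> U f" "x \<in> XX" "x' \<in> XX" "y \<in> YY"
  shows "mech_prob U f x y \<le> exp \<epsilon> * mech_prob U f x' y"
proof -
  have nonneg: "mech_prob U f z y \<ge> 0" for z by (simp add: mech_prob_def)
  have le: "ennreal (mech_prob U f x y) / ennreal (mech_prob U f x' y) \<le> ennreal (exp \<epsilon>)"
    using assms unfolding ldp_def by (meson SUP_upper order_trans)
  show ?thesis
  proof (cases "mech_prob U f x' y = 0")
    case True
    \<comment> \<open>A positive numerator over 0 would be \<open>top\<close>, exceeding the finite
      bound.\<close>
    then have "mech_prob U f x y = 0"
      using le nonneg[of x] by (cases "mech_prob U f x y = 0")
        (auto simp: ennreal_divide_zero top_unique)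
    then show ?thesis using True by simp
  next
    case False
    then have "mech_prob U f x' y > 0" using nonneg[of x'] by simp
    then show ?thesis
      using le nonneg[of x] by (simp add: divide_ennreal ennreal_le_iff divide_le_eq)
  qed
qed

lemma pmf_map_mech_prob: "pmf (map_pmf (f x) U) y = mech_prob U f x y"
  unfolding pmf_map mech_prob_def vimage_def by simp

lemma recoverable_iff_inj_on:
  "recoverable XX U f \<longleftrightarrow> (\<forall>u\<in>set_pmf U. inj_on (\<lambda>x. f x u) XX)"
proof
  assume "\<forall>u\<in>set_pmf U. inj_on (\<lambda>x. f x u) XX"
  then show "recoverable XX U f"
    unfolding recoverable_def
    by (intro exI[of _ "\<lambda>u. inv_into XX (\<lambda>x. f x u)"] ballI inv_into_f_f) auto
qed (auto simp: recoverable_def intro!: inj_onI; metis)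

text \<open>Each output in \<open>YY\<close> occurs for some input, and privacy forbids it to have
  probability 0 under any other.\<close>

lemma mech_prob_pos:
  assumes "ldp_rec XX UU YY \<epsilon> U f" "x \<in> XX" "y \<in> YY"
  shows "mech_prob U f x y > 0"
proof -
  have nonneg: "mech_prob U f z y \<ge> 0" for z by (simp add: mech_prob_def)
  obtain x' u where "x' \<in> XX" "u \<in> set_pmf U" "y = f x' u"
    using assms unfolding ldp_rec_def key_mechanism_def by blast
  then have "mech_prob U f x' y > 0"
    unfolding pmf_map_mech_prob[symmetric] by (intro pmf_positive) auto
  moreover have "mech_prob U f x' y \<le> exp \<epsilon> * mech_prob U f x y"
    using assms \<open>x' \<in> XX\<close> by (intro ldp_le[of XX YY]) (auto simp: ldp_rec_def)
  ultimately show ?thesis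
    using nonneg[of x] by (cases "mech_prob U f x y = 0") auto
qed

text \<open>For a fixed output the events that input \<open>x\<close> is sent to it are disjoint, because each key
  value sends at most one input there.\<close>

lemma sum_mech_prob_le_1:
  assumes "finite XX" "recoverable XX U f"
  shows "(\<Sum>x\<in>XX. mech_prob U f x y) \<le> 1"
proof -
  \<comment> \<open>Recovery speaks only of key values in the support, so the events are cut down to
    it; their probabilities do not change.\<close>
  let ?A = "\<lambda>x. {u \<in> set_pmf U. f x u = y}"
  have "(\<Sum>x\<in>XX. mech_prob U f x y) = (\<Sum>x\<in>XX. measure_pmf.prob U (?A x))"
    unfolding mech_prob_def
    by (intro sum.cong refl measure_pmf.finite_measure_eq_AE) (auto intro!: AE_pmfI)
  also have "\<dots> = measure_pmf.prob U (\<Union>x\<in>XX. ?A x)"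
  proof (rule measure_pmf.finite_measure_finite_Union[symmetric])
    show "disjoint_family_on ?A XX"
      using assms(2) unfolding recoverable_iff_inj_on disjoint_family_on_def inj_on_def by blast
  qed (use assms in auto)
  also have "\<dots> \<le> 1" by simp
  finally show ?thesis .
qed

section \<open>Necessity: lower bounds on key entropy and on cardinalities\<close>

lemma output_entropy_lower_bound:
  assumes "finite XX" "XX \<noteq> {}" "\<epsilon> \<ge> 0" "ldp_rec XX UU YY \<epsilon> U f"
  defines "h \<equiv> two_level_entropy \<epsilon> (card XX) (s_star \<epsilon> (card XX)) / ln 2"
  shows "h * (\<Sum>x\<in>XX. mech_prob U f x y)
           \<le> (\<Sum>x\<in>XX. - mech_prob U f x y * log 2 (mech_prob U f x y))"
proof (cases "y \<in> YY")
  case False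
  \<comment> \<open>Outputs outside \<open>YY\<close> contribute nothing, so \<open>y\<close> may
    later range over its whole type.\<close>
  have "mech_prob U f x y = 0" if "x \<in> XX" for x
    using assms(4) that False
    by (auto simp: ldp_rec_def key_mechanism_def pmf_map_mech_prob[symmetric] pmf_eq_0_set_pmf)
  then show ?thesis by simp
next
  case True
  define p where "p = (\<lambda>x. mech_prob U f x y)"
  have pos: "p x > 0" if "x \<in> XX" for x
    unfolding p_def using mech_prob_pos[OF assms(4) that True] .
  \<comment> \<open>Privacy compares every entry of the column with its smallest one, giving the two
    levels \<open>m\<close> and \<open>exp \<epsilon> * m\<close>.\<close>
  define m where "m = Min (p ` XX)"
  have "m \<in> p ` XX" unfolding m_def using assms(1,2) by (intro Min_in) auto
  then obtain x0 where x0: "x0 \<in> XX" "m = p x0" by blast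
  have bounds: "m \<le> p x \<and> p x \<le> exp \<epsilon> * m" if "x \<in> XX" for x
  proof
    show "m \<le> p x" using that assms(1) by (simp add: m_def)
    show "p x \<le> exp \<epsilon> * m"
      unfolding x0(2) p_def using that assms(4) x0(1) True
      by (intro ldp_le[of XX YY]) (auto simp: ldp_rec_def)
  qed
  have S: "sum p XX > 0" using assms(1,2) pos by (intro sum_pos) auto
  have "sum p XX \<le> 1"
    unfolding p_def using assms(1,4) by (intro sum_mech_prob_le_1) (auto simp: ldp_rec_def)
  then have "sum p XX * ln (sum p XX) \<le> 0"
    using S by (simp add: mult_nonneg_nonpos)
  moreover have "m > 0" using pos x0 by simp
  from entropy_bounded_ratio[of XX \<epsilon> m p, OF assms(1,2,3) this bounds]
  have "h * ln 2 * sum p XX \<le> sum p XX * ln (sum p XX) - (\<Sum>x\<in>XX. p x * ln (p x))"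
    by (simp add: h_def)
  ultimately have "h * ln 2 * sum p XX \<le> - (\<Sum>x\<in>XX. p x * ln (p x))" by linarith
  then have "(h * ln 2 * sum p XX) / ln 2 \<le> - (\<Sum>x\<in>XX. p x * ln (p x)) / ln 2"
    by (rule divide_right_mono) simp
  then have "h * sum p XX \<le> - (\<Sum>x\<in>XX. p x * ln (p x)) / ln 2" by simp
  also have "\<dots> = (\<Sum>x\<in>XX. - p x * log 2 (p x))"
    by (simp add: log_def sum_divide_distrib sum_negf)
  finally show ?thesis by (simp add: p_def)
qed

text \<open>The key determines each output, so its entropy is at least the average over the inputs of the
  output entropies.\<close>

lemma key_entropy_lower_bound:
  assumes "finite XX" "XX \<noteq> {}" "\<epsilon> \<ge> 0" "ldp_rec XX UU YY \<epsilon> U f"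
  shows "pmf_entropy (U_min \<epsilon> (card XX) (s_star \<epsilon> (card XX))) \<le> pmf_entropy U"
proof -
  let ?k = "card XX" and ?p = "\<lambda>x. map_pmf (f x) U"
  have k: "?k > 0" using assms by (simp add: card_gt_0_iff)
  define h where "h = two_level_entropy \<epsilon> ?k (s_star \<epsilon> ?k) / ln 2"
  have h: "h \<ge> 0" "pmf_entropy (U_min \<epsilon> ?k (s_star \<epsilon> ?k)) = ennreal h"
    using k s_star_le[OF assms(3), of ?k] assms(3)
    by (simp_all add: h_def pmf_entropy_U_min two_level_entropy_nonneg)
  have nonneg: "- pmf q y * log 2 (pmf q y) \<ge> 0" for q :: "'c pmf" and y
    using pmf_nonneg[of q y] pmf_le_1[of q y]
    by (cases "pmf q y = 0") (auto intro!: mult_nonneg_nonpos)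
  \<comment> \<open>The factor \<open>k\<close> is the total mass of the output laws. Exchanging the
    sum over inputs with the integral over outputs turns rows into columns, where the bound
    applies.\<close>
  have "of_nat ?k * ennreal h
      = (\<Sum>x\<in>XX. ennreal h * (\<integral>\<^sup>+ y. ennreal (pmf (?p x) y) \<partial>count_space UNIV))"
    by (simp add: nn_integral_pmf_eq_1)
  also have "\<dots> = (\<Sum>x\<in>XX. \<integral>\<^sup>+ y. ennreal (h * pmf (?p x) y) \<partial>count_space UNIV)"
    by (simp only: ennreal_mult[OF h(1) pmf_nonneg] nn_integral_cmult borel_measurable_count_space)
  also have "\<dots> = (\<integral>\<^sup>+ y. (\<Sum>x\<in>XX. ennreal (h * pmf (?p x) y)) \<partial>count_space UNIV)"
    by (rule nn_integral_sum[symmetric]) simp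
  also have "\<dots> = (\<integral>\<^sup>+ y. ennreal (h * (\<Sum>x\<in>XX. pmf (?p x) y)) \<partial>count_space UNIV)"
    using h(1) by (simp add: sum_ennreal sum_distrib_left)
  also have "\<dots> \<le> (\<integral>\<^sup>+ y. ennreal (\<Sum>x\<in>XX. - pmf (?p x) y * log 2 (pmf (?p x) y)) \<partial>count_space UNIV)"
    unfolding pmf_map_mech_prob h_def
    by (intro nn_integral_mono ennreal_leI output_entropy_lower_bound[OF assms])
  also have "\<dots> = (\<Sum>x\<in>XX. pmf_entropy (?p x))"
    unfolding pmf_entropy_count_space
    by (subst sum_ennreal[symmetric], rule nonneg, rule nn_integral_sum) simp
  also have "\<dots> \<le> (\<Sum>x\<in>XX. pmf_entropy U)"
    by (intro sum_mono pmf_entropy_map_le)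
  also have "\<dots> = of_nat ?k * pmf_entropy U" by simp
  finally show ?thesis
    unfolding h(2) using k
    by (subst (asm) ennreal_mult_le_mult_iff) auto
qed

text \<open>A single key value in the support injects inputs into outputs; a single input already
  reaches every output as the key varies.\<close>

lemma ldp_rec_lepoll:
  assumes "XX \<noteq> {}" "ldp_rec XX UU YY \<epsilon> U f"
  shows "XX \<lesssim> YY" "YY \<lesssim> UU"
proof -
  obtain u where u: "u \<in> set_pmf U" using set_pmf_not_empty[of U] by blast
  have "inj_on (\<lambda>x. f x u) XX" "(\<lambda>x. f x u) ` XX \<subseteq> YY"
    using assms u by (auto simp: ldp_rec_def recoverable_iff_inj_on key_mechanism_def)
  then show "XX \<lesssim> YY" unfolding lepoll_def by blast
  obtain x where x: "x \<in> XX" using assms by blast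
  have "YY \<subseteq> f x ` UU"
  proof
    fix y assume "y \<in> YY"
    then have "y \<in> set_pmf (map_pmf (f x) U)"
      using mech_prob_pos[OF assms(2) x] by (simp only: set_pmf_iff pmf_map_mech_prob) force
    then show "y \<in> f x ` UU"
      using assms(2) by (auto simp: ldp_rec_def key_mechanism_def)
  qed
  then show "YY \<lesssim> UU"
    by (rule lepoll_trans[OF subset_imp_lepoll image_lepoll])
qed

section \<open>Sufficiency: attaining the bound\<close>

text \<open>Optimal mechanism: a cyclic Latin square of outputs, keyed by the two-level distribution.\<close>

lemma ldp_rec_latin_square:
  fixes XX :: "'x set" and UU :: "'u set" and YY :: "'y set"
  assumes "finite XX" "card XX = k" "k > 0" "\<epsilon> \<ge> 0" "s \<le> k" "XX \<lesssim> YY" "XX \<lesssim> UU"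
  shows "\<exists>U f YY'. YY' \<subseteq> YY \<and> ldp_rec XX UU YY' \<epsilon> U f
           \<and> pmf_entropy U = pmf_entropy (U_min \<epsilon> k s)"
proof -
  obtain ix where ix: "bij_betw ix XX {..<k}"
    using assms(1,2) ex_bij_betw_finite_nat[of XX] by (auto simp: atLeast0LessThan)
  have "{..<k} \<lesssim> XX"
    using bij_betw_inv[OF ix] unfolding lepoll_def bij_betw_def by blast
  from lepoll_trans[OF this assms(6)] lepoll_trans[OF this assms(7)]
  obtain v :: "nat \<Rightarrow> 'y" and w :: "nat \<Rightarrow> 'u"
    where v: "inj_on v {..<k}" "v ` {..<k} \<subseteq> YY" and w: "inj_on w {..<k}" "w ` {..<k} \<subseteq> UU"
    unfolding lepoll_def by (elim exE conjE)
  let ?P = "U_min \<epsilon> k s"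
  define U where "U = map_pmf w ?P"
  \<comment> \<open>Input and key are numbered below \<open>k\<close> and added modulo
    \<open>k\<close>; fixing either one permutes the outputs.\<close>
  define f where "f = (\<lambda>x u. v ((ix x + inv_into {..<k} w u) mod k))"
  have P: "set_pmf ?P = {..<k}" using assms by (intro set_pmf_U_min)
  have U: "set_pmf U = w ` {..<k}" by (simp add: U_def P)
  have ixk: "ix x < k" if "x \<in> XX" for x using ix that by (auto simp: bij_betw_def)
  have add_inj: "inj_on (\<lambda>i. (a + i) mod k) {..<k}" for a
  proof (rule linorder_inj_onI)
    fix i j assume "i < j" "i \<in> {..<k}" "j \<in> {..<k}"
    \<comment> \<open>The difference is \<open>j - i\<close>, strictly between 0 and
      \<open>k\<close>.\<close>
    then have "\<not> k dvd (a + j) - (a + i)" by (auto dest: dvd_imp_le)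
    then show "(a + i) mod k \<noteq> (a + j) mod k"
      using \<open>i < j\<close> mod_eq_dvd_iff_nat[of "a + i" "a + j" k] by auto
  qed auto
  have add_image: "(\<lambda>i. (a + i) mod k) ` {..<k} = {..<k}" for a
    using assms(3) add_inj by (intro endo_inj_surj) auto
  have map_f: "map_pmf (f x) U = map_pmf (\<lambda>i. v ((ix x + i) mod k)) ?P" for x
    unfolding U_def map_pmf_comp f_def
    by (intro map_pmf_cong refl) (simp add: P inv_into_f_f[OF w(1)])
  have f_image: "f x ` set_pmf U = v ` {..<k}" for x
  proof -
    have "f x ` set_pmf U = set_pmf (map_pmf (f x) U)" by simp
    also have "\<dots> = v ` ((\<lambda>i. (ix x + i) mod k) ` {..<k})"
      unfolding map_f by (simp add: P image_image)
    finally show ?thesis by (simp add: add_image)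
  qed
  \<comment> \<open>Each row of output probabilities is a rearrangement of \<open>q_min\<close>, so
    privacy reduces to ratios of its entries.\<close>
  have prob: "\<exists>i<k. mech_prob U f x y = q_min \<epsilon> k s i" if y: "y \<in> v ` {..<k}" for x y
  proof -
    have "y \<in> v ` ((\<lambda>i. (ix x + i) mod k) ` {..<k})" using y add_image by simp
    then obtain i where i: "i < k" "y = v ((ix x + i) mod k)" by auto
    have "inj_on (\<lambda>i. v ((ix x + i) mod k)) {..<k}"
      using comp_inj_on[OF add_inj[of "ix x"], of v] v(1) add_image by (simp add: comp_def)
    then have "mech_prob U f x y = pmf ?P i"
      unfolding pmf_map_mech_prob[symmetric] map_f i(2)
      using pmf_map_inj[of "\<lambda>i. v ((ix x + i) mod k)" ?P i] i P by simp
    with i show ?thesis using assms by (auto simp: pmf_U_min)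
  qed
  have ratio: "q_min \<epsilon> k s i \<le> exp \<epsilon> * q_min \<epsilon> k s j" "q_min \<epsilon> k s j > 0" if "i < k" "j < k" for i j
  proof -
    have "1 \<le> exp \<epsilon>" "1 \<le> exp \<epsilon> * exp \<epsilon>"
      using assms(4) by (auto simp flip: exp_add)
    then show "q_min \<epsilon> k s i \<le> exp \<epsilon> * q_min \<epsilon> k s j" "q_min \<epsilon> k s j > 0"
      using that t_min_pos[OF assms(5,3), of \<epsilon>]
      by (auto simp: q_min_def divide_right_mono)
  qed
  have "key_mechanism XX UU (v ` {..<k}) U f"
    using w(2) assms(2,3) by (auto simp: key_mechanism_def U f_image[unfolded U])
  moreover have "ldp XX (v ` {..<k}) \<epsilon> U f"
    unfolding ldp_def
  proof (intro ballI SUP_least)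
    fix x x' y assume "y \<in> v ` {..<k}"
    then obtain i j where "i < k" "j < k" "mech_prob U f x y = q_min \<epsilon> k s i"
      "mech_prob U f x' y = q_min \<epsilon> k s j" using prob by metis
    then show "ennreal (mech_prob U f x y) / ennreal (mech_prob U f x' y) \<le> ennreal (exp \<epsilon>)"
      using ratio[of i j] ratio[of j i]
      by (simp add: divide_ennreal ennreal_le_iff divide_le_eq)
  qed
  moreover have "recoverable XX U f"
    unfolding recoverable_iff_inj_on
  proof (intro ballI inj_onI)
    fix u x x' assume *: "x \<in> XX" "x' \<in> XX" "f x u = f x' u"
    \<comment> \<open>The sum is symmetric, so \<open>add_inj\<close> applies with the key number as
      the fixed summand.\<close>
    then have "(inv_into {..<k} w u + ix x) mod k = (inv_into {..<k} w u + ix x') mod k"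
      using v(1) assms(3) by (auto simp: f_def inj_on_def add.commute)
    then have "ix x = ix x'" using add_inj ixk * by (auto simp: inj_on_def)
    then show "x = x'" using ix * by (auto simp: bij_betw_def inj_on_def)
  qed
  moreover have "pmf_entropy U = pmf_entropy ?P"
    unfolding U_def using w(1) by (intro pmf_entropy_map_inj) (simp add: P)
  ultimately show ?thesis using v(2) unfolding ldp_rec_def by blast
qed

text \<open>Sufficiency means that a mechanism exists within every admissible entropy budget
  \<open>h\<close>; one attaining the minimum serves all budgets. It outputs only \<open>k\<close>
  symbols, and \<open>key_mechanism\<close> demands the exact output set, hence the subset
  \<open>YY'\<close>.\<close>

theorem theorem4:
  fixes XX :: "'x set" and UU :: "'u set" and YY :: "'y set"
    and k :: nat and \<epsilon> :: real
  assumes "finite XX" and "card XX = k" and "k \<ge> 1" and "\<epsilon> \<ge> 0"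
  shows "(\<forall>U f. ldp_rec XX UU YY \<epsilon> U f \<longrightarrow>
            XX \<lesssim> YY \<and> YY \<lesssim> UU \<and>
            pmf_entropy U \<ge> pmf_entropy (U_min \<epsilon> k (s_star \<epsilon> k))) \<and>
         (\<forall>h. XX \<lesssim> YY \<and> YY \<lesssim> UU \<and>
            h \<ge> pmf_entropy (U_min \<epsilon> k (s_star \<epsilon> k)) \<longrightarrow>
            (\<exists>U f YY'. YY' \<subseteq> YY \<and> ldp_rec XX UU YY' \<epsilon> U f \<and> pmf_entropy U \<le> h))"
proof (intro conjI allI impI)
  have X: "XX \<noteq> {}" using assms by auto
  fix U f assume U: "ldp_rec XX UU YY \<epsilon> U f"
  show "XX \<lesssim> YY" "YY \<lesssim> UU" using ldp_rec_lepoll[OF X U] .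
  show "pmf_entropy (U_min \<epsilon> k (s_star \<epsilon> k)) \<le> pmf_entropy U"
    using key_entropy_lower_bound[OF assms(1) X assms(4) U] assms(2) by simp
next
  fix h assume h: "XX \<lesssim> YY \<and> YY \<lesssim> UU \<and> pmf_entropy (U_min \<epsilon> k (s_star \<epsilon> k)) \<le> h"
  then have "XX \<lesssim> YY" "XX \<lesssim> UU" using lepoll_trans by blast+
  then obtain U f YY' where "YY' \<subseteq> YY" "ldp_rec XX UU YY' \<epsilon> U f"
    "pmf_entropy U = pmf_entropy (U_min \<epsilon> k (s_star \<epsilon> k))"
    using ldp_rec_latin_square[OF assms(1,2) _ assms(4) s_star_le[OF assms(4)], of YY UU] assms(3)
    by auto
  with h show "\<exists>U f YY'. YY' \<subseteq> YY \<and> ldp_rec XX UU YY' \<epsilon> U f \<and> pmf_entropy U \<le> h"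
    by (intro exI[of _ U] exI[of _ f] exI[of _ YY']) simp
qed

end
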